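(* Let $F(X)=W^{U}G(W^{E}_{X})$ be an embedding-based model with embedding matrix $W^E\in\mathbb{R}^{d\times d_{\rm vob}}$ and unembedding matrix $W^U\in\mathbb{R}^{d_{\rm vob}\times d}$, trained by gradient flow on the averaged cross-entropy loss over a dataset $\{(X^i,y^i)\}_{i=1}^N$, where $X^i\in\mathcal{V}^L$ and $y^i\in\mathcal{V}$. Then for every token $\nu\in\mathcal{V}$, the gradient flow of the unembedding vector $W^U_\nu$ (the $\nu$-th row of $W^U$, written as a row vector) is $$\frac{dW^U_\nu}{dt}=\frac{r^{\rm out}_\nu}{N^{\rm out}_\nu}\sum_{i=1}^{N^{\rm out}_\nu}\left[G\!\left(W^E_{X^i_{(\cdot,\nu)}}\right)\right]^T-\frac1N\sum_{i=1}^Np^{i,\nu}\left[G\!\left(W^E_{X^i}\right)\right]^T,$$ where: - $N^{\rm out}_\nu$ is the number of dataset samples with label $\nu$, and $r^{\rm out}_\nu=N^{\rm out}_\nu/N$; - $X^i_{(\cdot,\nu)}$ is the sequence of the $i$-th dataset sample having label $\nu$; - $p^{i,\nu}$ is the $\nu$-th entry of $p^i=\mathrm{Softmax}(F(X^i))$. The first term is read as $0$ if $N^{\rm out}_\nu=0$.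
   Context: Vocabulary and embeddings. $\mathcal{V}$ is a vocabulary of $d_{\rm vob}$ tokens, identified with $\{1,\dots,d_{\rm vob}\}$. For $x\in\mathcal{V}$, $e_x\in\mathbb{R}^{d_{\rm vob}}$ is its one-hot vector and $W^E_x:=W^Ee_x\in\mathbb{R}^d$ is the $x$-th column of $W^E$. For a sequence $X=[x_1,\dots,x_L]\in\mathcal{V}^L$, $W^E_X:=[W^E_{x_1},\dots,W^E_{x_L}]\in\mathbb{R}^{d\times L}$. Model. An embedding-based model is $F(X)=W^UG(W^E_X)\in\mathbb{R}^{d_{\rm vob}}$, where $G:\mathbb{R}^{d\times L}\to\mathbb{R}^d$ is a mapping in the hidden space (not depending on $W^U$). Loss and gradient flow. The loss on sample $i$ is the cross-entropy $$\ell^i=-\log\mathrm{Softmax}(F(X^i))_{y^i}=-\log\frac{\exp F(X^i)_{y^i}}{\sum_{j=1}^{d_{\rm vob}}\exp F(X^i)_j}.$$ Gradient flow of $W^U_\nu$ means $\frac{dW^U_\nu}{dt}=-\frac1N\sum_{i=1}^N\frac{\partial\ell^i}{\partial W^U_\nu}$, all quantities on the right being evaluated at the parameters at time $t$. $T$ denotes the transpose. *)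

theory Defs
  imports "HOL-Analysis.Analysis"
begin

text \<open>
  Tokens form a finite type \<open>'v\<close>, so \<open>CARD('v)\<close> is the vocabulary size; the hidden dimension is
  \<open>CARD('d)\<close> and the sequence length is \<open>CARD('l)\<close>. Row vectors and column vectors are both
  elements of \<open>real ^ 'd\<close>, so the transposes that only turn columns into rows disappear.
\<close>

definition embed_token :: "real ^ 'v ^ 'd \<Rightarrow> 'v::finite \<Rightarrow> real ^ 'd" where
  "embed_token WE x = WE *v axis x 1"

definition embed_seq :: "real ^ 'v ^ 'd \<Rightarrow> 'v::finite ^ 'l \<Rightarrow> real ^ 'l ^ 'd" where
  "embed_seq WE X = (\<chi> k j. embed_token WE (X $ j) $ k)"

definition model ::
  "real ^ 'd ^ 'v \<Rightarrow> real ^ 'v ^ 'd \<Rightarrow> (real ^ 'l ^ 'd \<Rightarrow> real ^ 'd) \<Rightarrow> 'v::finite ^ 'l \<Rightarrow> real ^ 'v" where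
  "model WU WE G X = WU *v G (embed_seq WE X)"

definition softmax :: "real ^ 'v \<Rightarrow> real ^ 'v" where
  "softmax z = (\<chi> k. exp (z $ k) / (\<Sum>j\<in>UNIV. exp (z $ j)))"

definition cross_entropy ::
  "real ^ 'd ^ 'v \<Rightarrow> real ^ 'v ^ 'd \<Rightarrow> (real ^ 'l ^ 'd \<Rightarrow> real ^ 'd) \<Rightarrow> ('v::finite ^ 'l) \<times> 'v \<Rightarrow> real" where
  "cross_entropy WU WE G s = - ln (softmax (model WU WE G (fst s)) $ snd s)"

definition gradient :: "('a::real_inner \<Rightarrow> real) \<Rightarrow> 'a \<Rightarrow> 'a" where
  "gradient f x = (THE D. GDERIV f x :> D)"

lemma gradient_eqI:
  assumes "GDERIV f x :> D"
  shows "gradient f x = D"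
  unfolding gradient_def
proof (rule the_equality)
  fix D' assume "GDERIV f x :> D'"
  with assms have "(\<lambda>h. h \<bullet> D') = (\<lambda>h. h \<bullet> D)"
    unfolding gderiv_def by (metis has_derivative_unique)
  then show "D' = D"
    by (metis vector_eq_ldot)
qed (fact assms)

definition replace_row :: "real ^ 'd ^ 'v \<Rightarrow> 'v::finite \<Rightarrow> real ^ 'd \<Rightarrow> real ^ 'd ^ 'v" where
  "replace_row W \<nu> u = (\<chi> i. if i = \<nu> then u else row i W)"

definition loss_row_gradient ::
  "real ^ 'd ^ 'v \<Rightarrow> real ^ 'v ^ 'd \<Rightarrow> (real ^ 'l ^ 'd \<Rightarrow> real ^ 'd) \<Rightarrow>
   ('v::finite ^ 'l) \<times> 'v \<Rightarrow> 'v \<Rightarrow> real ^ 'd" where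
  "loss_row_gradient WU WE G s \<nu> =
     gradient (\<lambda>u. cross_entropy (replace_row WU \<nu> u) WE G s) (row \<nu> WU)"

text \<open>
  \<open>T\<close> is the time domain of the trajectory. The embedding matrix and the hidden mapping may
  move with time as well (they have trainable parameters of their own), in an arbitrary way.
\<close>

definition unembedding_gradient_flow ::
  "real set \<Rightarrow> (real \<Rightarrow> real ^ 'd ^ 'v) \<Rightarrow> (real \<Rightarrow> real ^ 'v ^ 'd) \<Rightarrow>
   (real \<Rightarrow> real ^ 'l ^ 'd \<Rightarrow> real ^ 'd) \<Rightarrow> (('v::finite ^ 'l) \<times> 'v) list \<Rightarrow> bool" where
  "unembedding_gradient_flow T WU WE G D \<longleftrightarrow>
     (\<forall>\<nu>. \<forall>t\<in>T. ((\<lambda>\<tau>. row \<nu> (WU \<tau>)) has_vector_derivative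
        - ((1 / real (length D)) *\<^sub>R
             (\<Sum>i<length D. loss_row_gradient (WU t) (WE t) (G t) (D ! i) \<nu>))) (at t within T))"

definition samples_with_label :: "(('v ^ 'l) \<times> 'v) list \<Rightarrow> 'v \<Rightarrow> (('v ^ 'l) \<times> 'v) list" where
  "samples_with_label D \<nu> = filter (\<lambda>s. snd s = \<nu>) D"

definition N_out :: "(('v ^ 'l) \<times> 'v) list \<Rightarrow> 'v \<Rightarrow> nat" where
  "N_out D \<nu> = length (samples_with_label D \<nu>)"

definition r_out :: "(('v ^ 'l) \<times> 'v) list \<Rightarrow> 'v \<Rightarrow> real" where
  "r_out D \<nu> = real (N_out D \<nu>) / real (length D)"

definition X_out :: "(('v ^ 'l) \<times> 'v) list \<Rightarrow> 'v \<Rightarrow> nat \<Rightarrow> 'v ^ 'l" where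
  "X_out D \<nu> i = fst (samples_with_label D \<nu> ! i)"

end

theory Submission
  imports Defs
begin

text \<open>With time frozen, write h for the hidden vector of a sample. Row \<nu> of the
  unembedding matrix enters that sample's loss only through the logit u \<bullet> h. The derivative
  of cross-entropy in logit \<nu> is the softmax probability minus the indicator that the label is
  \<nu>, and the chain rule multiplies it by h (\<open>GDERIV_cross_entropy_row\<close>). In the
  negated average over the dataset, the probabilities give the second term. The indicators keep
  exactly the samples labelled \<nu> (\<open>sum_samples_with_label\<close>), and the factor 1/N in
  front of them is \<open>r_out\<close> divided by \<open>N_out\<close>.\<close>

lemma sum_exp_pos: "(\<Sum>j\<in>UNIV. exp (z $ j)) > 0" for z :: "real ^ 'v::finite"
  by (intro sum_pos) auto

lemma minus_ln_softmax:
  "- ln (softmax z $ y) = ln (\<Sum>j\<in>UNIV. exp (z $ j)) - z $ y"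
  using sum_exp_pos[of z] by (simp add: softmax_def ln_div)

lemma replace_row_mult_nth:
  "(replace_row W \<nu> u *v h) $ j = (if j = \<nu> then u else row j W) \<bullet> h"
  by (simp add: replace_row_def matrix_vector_mult_def inner_vec_def row_def)

lemma sum_UNIV_replace:
  fixes f g :: "'v::finite \<Rightarrow> real"
  shows "(\<Sum>j\<in>UNIV. if j = \<nu> then g j else f j) = g \<nu> + (\<Sum>j\<in>UNIV - {\<nu>}. f j)"
  by (subst sum.remove[of UNIV \<nu>]) (auto intro!: sum.cong)

text \<open>Isolates the dependence on \<open>u\<close>: splitting index \<nu> off the partition
  function leaves one varying exponential plus a constant, and the label's logit is linear in
  \<open>u\<close> or constant.\<close>

lemma cross_entropy_replace_row:
  fixes WU :: "real ^ 'd::finite ^ 'v::finite"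
  shows "cross_entropy (replace_row WU \<nu> u) WE G s =
    ln (exp (u \<bullet> G (embed_seq WE (fst s)))
      + (\<Sum>j\<in>UNIV - {\<nu>}. exp (row j WU \<bullet> G (embed_seq WE (fst s)))))
    - (if snd s = \<nu> then u else row (snd s) WU) \<bullet> G (embed_seq WE (fst s))"
proof -
  let ?h = "G (embed_seq WE (fst s))"
  have "(\<Sum>j\<in>UNIV. exp ((if j = \<nu> then u else row j WU) \<bullet> ?h))
      = exp (u \<bullet> ?h) + (\<Sum>j\<in>UNIV - {\<nu>}. exp (row j WU \<bullet> ?h))"
    by (simp add: if_distrib[of "\<lambda>v. exp (v \<bullet> ?h)"] sum_UNIV_replace)
  then show ?thesis
    by (simp add: cross_entropy_def minus_ln_softmax model_def replace_row_mult_nth)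
qed

text \<open>Splits the denominator in the same way as the loss, so that the quotient produced by
  differentiating the logarithm is recognised as this probability.\<close>

lemma softmax_model_nth:
  fixes WU :: "real ^ 'd::finite ^ 'v::finite"
  shows "softmax (model WU WE G X) $ \<nu> = exp (row \<nu> WU \<bullet> G (embed_seq WE X)) /
    (exp (row \<nu> WU \<bullet> G (embed_seq WE X))
      + (\<Sum>j\<in>UNIV - {\<nu>}. exp (row j WU \<bullet> G (embed_seq WE X))))"
proof -
  have "(WU *v h) $ j = row j WU \<bullet> h" for j h
    by (simp add: matrix_vector_mult_def inner_vec_def row_def)
  then show ?thesis
    by (simp add: softmax_def model_def sum.remove[of UNIV \<nu>])
qed

lemma GDERIV_cross_entropy_row:
  fixes WU :: "real ^ 'd::finite ^ 'v::finite"
  shows "GDERIV (\<lambda>u. cross_entropy (replace_row WU \<nu> u) WE G s) (row \<nu> WU) :>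
    (softmax (model WU WE G (fst s)) $ \<nu> - of_bool (snd s = \<nu>)) *\<^sub>R G (embed_seq WE (fst s))"
proof -
  define h where "h = G (embed_seq WE (fst s))"
  define C where "C = (\<Sum>j\<in>UNIV - {\<nu>}. exp (row j WU \<bullet> h))"
  have "C \<ge> 0"
    unfolding C_def by (intro sum_nonneg) auto
  \<comment> \<open>\<open>C\<close> is an empty sum for a one-token vocabulary, so strictness must
    come from the exponential. This makes the logarithm differentiable.\<close>
  then have pos: "C + exp (u \<bullet> h) > 0" for u
    by (simp add: add_nonneg_pos)
  have "((\<lambda>u. ln (exp (u \<bullet> h) + C) - (if snd s = \<nu> then u else row (snd s) WU) \<bullet> h)
      has_derivative (\<lambda>v. exp (row \<nu> WU \<bullet> h) * (v \<bullet> h) / (exp (row \<nu> WU \<bullet> h) + C)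
        - of_bool (snd s = \<nu>) * (v \<bullet> h))) (at (row \<nu> WU))"
    by (cases "snd s = \<nu>") (auto intro!: derivative_eq_intros simp: pos field_simps)
  then show ?thesis
    by (simp add: gderiv_def cross_entropy_replace_row softmax_model_nth h_def C_def
        inner_commute algebra_simps)
qed

lemma loss_row_gradient_eq:
  fixes WU :: "real ^ 'd::finite ^ 'v::finite"
  shows "loss_row_gradient WU WE G s \<nu> =
    (softmax (model WU WE G (fst s)) $ \<nu>) *\<^sub>R G (embed_seq WE (fst s))
    - (if snd s = \<nu> then G (embed_seq WE (fst s)) else 0)"
  unfolding loss_row_gradient_def gradient_eqI[OF GDERIV_cross_entropy_row]
  by (simp add: algebra_simps)

text \<open>Both sides are sums over lists, where an indicator weight amounts to filtering; repeated
  samples keep their multiplicity.\<close>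

lemma sum_samples_with_label:
  fixes f :: "'v ^ 'l \<Rightarrow> 'b::comm_monoid_add"
  shows "(\<Sum>i<length D. if snd (D ! i) = \<nu> then f (fst (D ! i)) else 0)
    = (\<Sum>i<N_out D \<nu>. f (X_out D \<nu> i))"
proof -
  have "(\<Sum>i<length D. if snd (D ! i) = \<nu> then f (fst (D ! i)) else 0)
      = (\<Sum>s\<leftarrow>D. if snd s = \<nu> then f (fst s) else 0)"
    by (simp add: sum_list_sum_nth atLeast0LessThan)
  also have "\<dots> = (\<Sum>s\<leftarrow>samples_with_label D \<nu>. f (fst s))"
    by (simp add: samples_with_label_def sum_list_map_filter')
  also have "\<dots> = (\<Sum>i<N_out D \<nu>. f (X_out D \<nu> i))"
    by (simp add: sum_list_sum_nth atLeast0LessThan N_out_def X_out_def)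
  finally show ?thesis .
qed

theorem proposition2:
  fixes WU :: "real \<Rightarrow> real ^ 'd::finite ^ 'v::finite"
    and WE :: "real \<Rightarrow> real ^ 'v ^ 'd"
    and G :: "'p \<Rightarrow> real ^ 'l::finite ^ 'd \<Rightarrow> real ^ 'd"
    and \<theta> :: "real \<Rightarrow> 'p"
    and D :: "(('v ^ 'l) \<times> 'v) list"
    and T :: "real set"
  assumes "D \<noteq> []"
    and "unembedding_gradient_flow T WU WE (\<lambda>t. G (\<theta> t)) D"
  shows "\<forall>\<nu>. \<forall>t\<in>T. ((\<lambda>\<tau>. row \<nu> (WU \<tau>)) has_vector_derivative
     (r_out D \<nu> / real (N_out D \<nu>)) *\<^sub>R
        (\<Sum>i<N_out D \<nu>. G (\<theta> t) (embed_seq (WE t) (X_out D \<nu> i)))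
     - (1 / real (length D)) *\<^sub>R
        (\<Sum>i<length D. (softmax (model (WU t) (WE t) (G (\<theta> t)) (fst (D ! i))) $ \<nu>) *\<^sub>R
           G (\<theta> t) (embed_seq (WE t) (fst (D ! i))))) (at t within T)"
proof (intro allI ballI)
  fix \<nu> t assume "t \<in> T"
  let ?g = "\<lambda>X. G (\<theta> t) (embed_seq (WE t) X)"
  let ?p = "\<lambda>X. softmax (model (WU t) (WE t) (G (\<theta> t)) X) $ \<nu>"
  let ?A = "\<Sum>i<N_out D \<nu>. ?g (X_out D \<nu> i)"
  let ?B = "\<Sum>i<length D. ?p (fst (D ! i)) *\<^sub>R ?g (fst (D ! i))"
  have grad: "(\<Sum>i<length D. loss_row_gradient (WU t) (WE t) (G (\<theta> t)) (D ! i) \<nu>) = ?B - ?A"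
    by (simp add: loss_row_gradient_eq sum_subtractf sum_samples_with_label[where f = ?g])
  \<comment> \<open>If no sample has label \<nu>, the sum \<open>?A\<close> is empty and both sides
    are 0; otherwise \<open>N_out\<close> cancels.\<close>
  have A: "(r_out D \<nu> / real (N_out D \<nu>)) *\<^sub>R ?A = (1 / real (length D)) *\<^sub>R ?A"
    by (cases "N_out D \<nu> = 0") (simp_all add: r_out_def)
  have "((\<lambda>\<tau>. row \<nu> (WU \<tau>)) has_vector_derivative
      - ((1 / real (length D)) *\<^sub>R (?B - ?A))) (at t within T)"
    using assms(2)[unfolded unembedding_gradient_flow_def, rule_format, OF \<open>t \<in> T\<close>, of \<nu>]
    unfolding grad .
  then show "((\<lambda>\<tau>. row \<nu> (WU \<tau>)) has_vector_derivative
      (r_out D \<nu> / real (N_out D \<nu>)) *\<^sub>R ?A - (1 / real (length D)) *\<^sub>R ?B) (at t within T)"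
    unfolding A by (simp add: scaleR_diff_right)
qed

end
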